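(* Let $A$ be a finite nonempty subset of $\mathbb{R}\setminus\{0\}$. Then \[ |AA|\gtrsim E_3^+(A)^{4/3}|A|^{-10/3}. \]
   Context: $AA=\{ab:a,b\in A\}$. $E_3^+(A)=\sum_x r_{A-A}(x)^3$ where $r_{A-A}(x)=\#\{(a,b)\in A\times A: a-b=x\}$. Notation: $X\lesssim Y$ means $X\le C\,Y(\log(2+|A|))^{c}$ for absolute constants $C,c>0$; $X\gtrsim Y$ means $Y\lesssim X$. *)

theory Defs
  imports "HOL-Analysis.Analysis"
begin

definition prod_set :: "real set \<Rightarrow> real set" where
  "prod_set A = {a * b | a b. a \<in> A \<and> b \<in> A}"

definition diff_set :: "real set \<Rightarrow> real set" where
  "diff_set A = {a - b | a b. a \<in> A \<and> b \<in> A}"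

definition rdiff :: "real set \<Rightarrow> real \<Rightarrow> nat" where
  "rdiff A x = card {(a, b). a \<in> A \<and> b \<in> A \<and> a - b = x}"

text \<open>E_3^+(A) = sum over x of r_{A-A}(x)^3; only x in A - A contribute.\<close>
definition E3plus :: "real set \<Rightarrow> nat" where
  "E3plus A = (\<Sum>x\<in>diff_set A. rdiff A x ^ 3)"

end

theory Submission
  imports Defs
begin

text \<open>Let \<open>D\<close> be the set of differences with at least \<open>\<tau>\<close> representations; up to a logarithm it
  suffices to bound \<open>|D| \<tau>\<^sup>3\<close> uniformly in \<open>\<tau>\<close>. For sets \<open>P\<close>, \<open>Q\<close> put
  \<open>A\<^sub>b = {a \<in> A. b - a \<in> Q}\<close> for \<open>b \<in> P\<close>. By Cauchy--Schwarz, the multiplicative energy of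
  \<open>A\<^sub>b\<close> and \<open>A\<^sub>b\<^sub>'\<close> is at least \<open>|A\<^sub>b|\<^sup>2 |A\<^sub>b\<^sub>'|\<^sup>2 / |AA|\<close>. On the other hand, a ratio
  \<open>r\<close> with many representations \<open>a' = r a\<close>, \<open>a \<in> A\<^sub>b\<close>, \<open>a' \<in> A\<^sub>b\<^sub>'\<close>, gives a line of slope \<open>r\<close>
  through the point \<open>(b, b')\<close> of the grid \<open>P \<times> P\<close> that is rich in the grid \<open>Q \<times> Q\<close>. Incidence
  bounds of Szemeredi--Trotter strength, which are elementary for grids, bound the number of rich
  lines and then their incidences with \<open>P \<times> P\<close>, hence the sum of all these energies. This is
  Solymosi's argument for the sum-product exponent 14/11, restricted to popular differences. It is
  applied with \<open>P = A\<close>, \<open>Q = D\<close> if \<open>|A| \<le> |D|\<close>, and with \<open>P = D\<close>, \<open>Q = -A\<close> otherwise.\<close>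

section \<open>Incidences of lines with grids\<close>

text \<open>Fix one representative in each fibre of \<open>f\<close>. Every other element of
  \<open>S\<close> collides with its representative, and representatives inject into the
  image.\<close>

lemma card_le_card_image_plus_collisions:
  assumes "finite S"
  shows "card S \<le> card (f ` S) + card {(x, y). x \<in> S \<and> y \<in> S \<and> x \<noteq> y \<and> f x = f y}"
    (is "_ \<le> _ + card ?C")
proof -
  define \<rho> where "\<rho> x = inv_into S f (f x)" for x
  have \<rho>: "\<rho> x \<in> S" "f (\<rho> x) = f x" if "x \<in> S" for x
    using that by (auto simp: \<rho>_def inv_into_into f_inv_into_f)
  have "finite ?C"
    by (rule finite_subset[of _ "S \<times> S"]) (use assms in auto)
  moreover have "(\<lambda>x. (x, \<rho> x)) ` (S - \<rho> ` S) \<subseteq> ?C"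
    using \<rho> by force
  ultimately have "card (S - \<rho> ` S) \<le> card ?C"
    by (intro card_inj_on_le) (auto simp: inj_on_def)
  moreover have "card (\<rho> ` S) \<le> card (f ` S)"
  proof -
    have "\<rho> ` S = inv_into S f ` f ` S" by (auto simp: \<rho>_def)
    then show ?thesis using assms by (metis card_image_le finite_imageI)
  qed
  moreover have "card S \<le> card (S - \<rho> ` S) + card (\<rho> ` S)"
    using assms by (metis card_Un_le Un_Diff_cancel2 Un_absorb2 \<rho>(1) image_subsetI)
  ultimately show ?thesis by linarith
qed

text \<open>Cuts the real line into consecutive intervals holding at most \<open>k\<close> points of
  \<open>X\<close> each. The argument may be any real, so monotonicity is available along a whole
  line, also off the grid.\<close>

definition block :: "real set \<Rightarrow> nat \<Rightarrow> real \<Rightarrow> nat" where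
  "block X k x = card {y \<in> X. y < x} div k"

lemma block_mono: "finite X \<Longrightarrow> x \<le> y \<Longrightarrow> block X k x \<le> block X k y"
  unfolding block_def by (intro div_le_mono card_mono) auto

lemma block_le: "finite X \<Longrightarrow> block X k x \<le> card X div k"
  unfolding block_def by (intro div_le_mono card_mono) auto

lemma card_block_le:
  assumes "finite X" "k > 0"
  shows "card {x \<in> X. block X k x = j} \<le> k"
proof -
  let ?rank = "\<lambda>x. card {y \<in> X. y < x}"
  have less: "?rank x < ?rank x'" if "x \<in> X" "x < x'" for x x'
    using assms that by (intro psubset_card_mono) auto
  have "inj_on ?rank X"
    using less by (intro linorder_inj_onI') (use less_irrefl in fastforce)
  moreover have "?rank ` {x \<in> X. block X k x = j} \<subseteq> {j * k..<j * k + k}"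
  proof (rule image_subsetI)
    fix x assume "x \<in> {x \<in> X. block X k x = j}"
    then have "?rank x = j * k + ?rank x mod k" by (auto simp: block_def)
    moreover have "?rank x mod k < k" using assms by simp
    ultimately show "?rank x \<in> {j * k..<j * k + k}"
      unfolding atLeastLessThan_iff by linarith
  qed
  ultimately have "card {x \<in> X. block X k x = j} \<le> card {j * k..<j * k + k}"
    by (intro card_inj_on_le[where f = ?rank]) (auto intro: inj_on_subset)
  then show ?thesis by simp
qed

lemma card_same_block_le:
  assumes "finite X" "k > 0"
  shows "card {(x, x'). x \<in> X \<and> x' \<in> X \<and> block X k x = block X k x'} \<le> card X * k"
proof -
  have "{(x, x'). x \<in> X \<and> x' \<in> X \<and> block X k x = block X k x'}
      = (SIGMA x:X. {x' \<in> X. block X k x' = block X k x})" by auto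
  also have "card \<dots> = (\<Sum>x\<in>X. card {x' \<in> X. block X k x' = block X k x})"
    using assms by (intro card_SigmaI) auto
  also have "\<dots> \<le> (\<Sum>x\<in>X. k)" by (intro sum_mono card_block_le assms)
  finally show ?thesis by simp
qed

text \<open>Along a non-vertical line both block indices are monotone, so the cells that the line meets
  are separated by the sum, or the difference, of the two indices.\<close>

lemma card_cells_on_line_le:
  fixes m c :: real
  assumes "finite X"
  shows "card ((\<lambda>x. (block X k x, block X k (m * x + c))) ` S) \<le> 2 * (card X div k) + 1"
    (is "card (?\<phi> ` S) \<le> 2 * ?R + 1")
proof -
  \<comment> \<open>For negative slope the second index is reversed, so that both summands increase
    with \<open>x\<close>. The truncated subtraction is exact because every block index is at most
    \<open>?R\<close>.\<close>
  let ?s = "if m \<ge> 0 then (\<lambda>(i, j). i + j) else (\<lambda>(i, j). i + (?R - j))"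
  have R: "block X k x \<le> ?R" for x by (rule block_le) fact
  have eq: "?\<phi> x = ?\<phi> y" if "?s (?\<phi> x) = ?s (?\<phi> y)" "x \<le> y" for x y
  proof (cases "m \<ge> 0")
    case True
    then have "m * x + c \<le> m * y + c" using that by (simp add: mult_left_mono)
    from block_mono[OF assms this, of k] block_mono[OF assms that(2), of k] that(1) True
    show ?thesis by auto
  next
    case False
    then have "m * y + c \<le> m * x + c" using that by (simp add: mult_left_mono_neg)
    from block_mono[OF assms this, of k] block_mono[OF assms that(2), of k] that(1) False
      R[of "m * x + c"] R[of "m * y + c"]
    show ?thesis by auto
  qed
  have "inj_on ?s (?\<phi> ` S)"
  proof (rule inj_onI, elim imageE)
    fix u v x y assume "?s u = ?s v" "u = ?\<phi> x" "v = ?\<phi> y"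
    then show "u = v" using eq[of x y] eq[of y x] by (metis linear)
  qed
  moreover have "?s ` ?\<phi> ` S \<subseteq> {..2 * ?R}"
  proof -
    have "?s (?\<phi> x) \<in> {..2 * ?R}" for x
      using R[of x] R[of "m * x + c"] by auto
    then show ?thesis by blast
  qed
  ultimately have "card (?\<phi> ` S) \<le> card {..2 * ?R}"
    by (intro card_inj_on_le) auto
  then show ?thesis by simp
qed

text \<open>A line is coded as (slope, intercept). It is a graph, so its points in the grid
  \<open>X \<times> X\<close> are recorded by their abscissae alone.\<close>

definition line_pts :: "real set \<Rightarrow> real \<times> real \<Rightarrow> real set" where
  "line_pts X l = {x \<in> X. fst l * x + snd l \<in> X}"

lemma finite_line_pts [simp]: "finite X \<Longrightarrow> finite (line_pts X l)"
  by (simp add: line_pts_def)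

text \<open>Within one cell, all but one of the incidences of a line are paid for by pairs of points of that
  cell, and each pair lies on only one line.\<close>

lemma incidences_le:
  assumes X: "finite X" and L: "finite L" and k: "k > 0"
  shows "(\<Sum>l\<in>L. card (line_pts X l)) \<le> (2 * (card X div k) + 1) * card L + (card X * k)\<^sup>2"
proof -
  define h where "h = block X k"
  define C where "C l = {(x, x'). x \<in> line_pts X l \<and> x' \<in> line_pts X l \<and> x \<noteq> x' \<and>
    (h x, h (fst l * x + snd l)) = (h x', h (fst l * x' + snd l))}" for l
  define B where "B = {(x, x'). x \<in> X \<and> x' \<in> X \<and> h x = h x'}"
  have finC: "finite (C l)" for l
    by (rule finite_subset[of _ "X \<times> X"]) (use X in \<open>auto simp: C_def line_pts_def\<close>)
  have finB: "finite B"
    by (rule finite_subset[of _ "X \<times> X"]) (use X in \<open>auto simp: B_def\<close>)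
  have "card (line_pts X l) \<le> 2 * (card X div k) + 1 + card (C l)" for l
    using card_le_card_image_plus_collisions[of "line_pts X l" "\<lambda>x. (h x, h (fst l * x + snd l))"]
      card_cells_on_line_le[OF X, of k "fst l" "snd l" "line_pts X l"] X
    unfolding C_def h_def by fastforce
  then have "(\<Sum>l\<in>L. card (line_pts X l)) \<le> (\<Sum>l\<in>L. 2 * (card X div k) + 1 + card (C l))"
    by (intro sum_mono)
  also have "\<dots> = (2 * (card X div k) + 1) * card L + (\<Sum>l\<in>L. card (C l))"
    by (simp only: sum.distrib sum_constant) (simp add: mult.commute)
  also have "(\<Sum>l\<in>L. card (C l)) = card (SIGMA l:L. C l)"
    using L finC by simp
  also have "\<dots> \<le> card (B \<times> B)"
  proof (rule card_inj_on_le)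
    \<comment> \<open>A pair of points is regrouped into its abscissae and its ordinates. Two points
      of one cell share a block in each coordinate, which places the image in
      \<open>B \<times> B\<close>.\<close>
    let ?g = "\<lambda>(l :: real \<times> real, (x, x')).
      ((x, x'), (fst l * x + snd l, fst l * x' + snd l))"
    show "inj_on ?g (Sigma L C)"
    proof (rule inj_onI)
      fix u v assume uv: "u \<in> Sigma L C" "v \<in> Sigma L C" "?g u = ?g v"
      obtain m c x x' m' c' y y' where u: "u = ((m, c), (x, x'))" and v: "v = ((m', c'), (y, y'))"
        by (metis surj_pair)
      from uv u v have "x \<noteq> x'" and xy: "x = y" "x' = y'"
        and e: "m * x + c = m' * x + c'" "m * x' + c = m' * x' + c'"
        by (auto simp: C_def)
      from e have "(m - m') * (x - x') = 0" by (simp add: algebra_simps)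
      with \<open>x \<noteq> x'\<close> have "m = m'" by simp
      with e show "u = v" using u v xy by simp
    qed
    show "?g ` Sigma L C \<subseteq> B \<times> B"
      by (auto simp: B_def C_def line_pts_def)
  qed (use finB in simp)
  also have "\<dots> \<le> (card X * k)\<^sup>2"
    using card_same_block_le[OF X k] unfolding card_cartesian_product power2_eq_square B_def h_def
    by (rule mult_mono) (use card_same_block_le[OF X k] in auto)
  finally show ?thesis by simp
qed

text \<open>Blocks of length about \<open>N / \<rho>\<close> give at most \<open>\<rho>\<close> for
  the quotient \<open>card X div k\<close>. Since \<open>N / \<rho>\<close> is at least 1, rounding
  it up at most doubles it, whence the 4. The parameter \<open>\<rho>\<close> stays free for later
  optimisation.\<close>

lemma incidences_le_real:
  fixes \<rho> :: real
  assumes X: "finite X" and L: "finite L" and \<rho>: "1 \<le> \<rho>" "\<rho> \<le> card X"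
  shows "(\<Sum>l\<in>L. real (card (line_pts X l))) \<le> 3 * \<rho> * card L + 4 * real (card X) ^ 4 / \<rho>\<^sup>2"
proof -
  define N where "N = real (card X)"
  define k where "k = nat \<lceil>N / \<rho>\<rceil>"
  have N: "N \<ge> 1" using \<rho> by (simp add: N_def)
  have q: "N / \<rho> \<ge> 1" using \<rho> by (simp add: N_def)
  then have k1: "N / \<rho> \<le> k" and k2: "k \<le> 2 * (N / \<rho>)" and k: "k > 0"
    unfolding k_def by linarith+
  have "real (card X div k) \<le> N / k" by (simp add: N_def of_nat_div_le_of_nat)
  also have "\<dots> \<le> N / (N / \<rho>)" using k1 q N k \<rho> by (intro divide_left_mono) auto
  also have "\<dots> = \<rho>" using N by simp
  finally have R: "real (card X div k) \<le> \<rho>" .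
  have "(\<Sum>l\<in>L. real (card (line_pts X l))) \<le> real ((2 * (card X div k) + 1) * card L + (card X * k)\<^sup>2)"
    using incidences_le[OF X L k] by (metis of_nat_le_iff of_nat_sum)
  also have "\<dots> = (2 * real (card X div k) + 1) * card L + (N * k)\<^sup>2"
    by (simp add: N_def algebra_simps)
  also have "\<dots> \<le> (3 * \<rho>) * card L + (N * (2 * (N / \<rho>)))\<^sup>2"
    using R k2 N \<rho> by (intro add_mono mult_right_mono power_mono mult_left_mono) auto
  also have "(N * (2 * (N / \<rho>)))\<^sup>2 = 4 * N ^ 4 / \<rho>\<^sup>2"
    by (simp add: power2_eq_square power4_eq_xxxx)
  finally show ?thesis by (simp add: N_def)
qed

text \<open>With \<open>\<rho> = t / 8\<close> the linear term is \<open>3 * t / 8\<close> per line,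
  less than half of what each rich line contributes, and is absorbed on the left. The condition on
  \<open>t\<close> makes this \<open>\<rho>\<close> at least 1.\<close>

lemma rich_lines_le:
  assumes X: "finite X" and L: "finite L" and t: "8 \<le> t"
    and rich: "\<And>l. l \<in> L \<Longrightarrow> t \<le> real (card (line_pts X l))"
  shows "real (card L) \<le> 512 * real (card X) ^ 4 / t ^ 3"
proof (cases "L = {}")
  case False
  then obtain l where "l \<in> L" by blast
  have "card (line_pts X l) \<le> card X" by (rule card_mono) (use X in \<open>auto simp: line_pts_def\<close>)
  with rich[OF \<open>l \<in> L\<close>] have "t \<le> card X" by linarith
  have "t * card L = (\<Sum>l\<in>L. t)" by simp
  also have "\<dots> \<le> (\<Sum>l\<in>L. real (card (line_pts X l)))" by (intro sum_mono rich)
  also have "\<dots> \<le> 3 * (t / 8) * card L + 4 * real (card X) ^ 4 / (t / 8)\<^sup>2"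
    using t \<open>t \<le> card X\<close> by (intro incidences_le_real X L) auto
  finally have "t * card L - 3 * (t / 8) * card L \<le> 256 * real (card X) ^ 4 / t\<^sup>2"
    by (simp add: power2_eq_square)
  moreover have "t * card L / 2 \<le> t * card L - 3 * (t / 8) * card L"
    using t by (simp add: field_simps)
  ultimately have "t * card L / 2 \<le> 256 * real (card X) ^ 4 / t\<^sup>2" by linarith
  then show ?thesis using t by (simp add: field_simps power2_eq_square power3_eq_cube)
qed (use t in simp)

section \<open>Ratios and multiplicative energy\<close>

text \<open>Cauchy-Schwarz over the fibres of \<open>f\<close>.\<close>

lemma card_squared_le_collisions:
  assumes "finite Z"
  shows "(card Z)\<^sup>2 \<le> card (f ` Z) * card {(z, z'). z \<in> Z \<and> z' \<in> Z \<and> f z = f z'}"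
proof -
  define F where "F y = {z \<in> Z. f z = y}" for y
  have "card Z = (\<Sum>y\<in>f ` Z. card (F y))"
    using sum.image_gen[OF assms, of "\<lambda>_. 1 :: nat" f] by (simp add: F_def)
  then have "(real (card Z))\<^sup>2 = (\<Sum>y\<in>f ` Z. real (card (F y)))\<^sup>2" by simp
  also have "\<dots> \<le> (\<Sum>y\<in>f ` Z. (real (card (F y)))\<^sup>2) * card (f ` Z)"
    using sum_squared_le_sum_of_squares[of "\<lambda>y. real (card (F y))" "f ` Z"] by (simp add: mult.commute)
  also have "(\<Sum>y\<in>f ` Z. (real (card (F y)))\<^sup>2) = real (\<Sum>y\<in>f ` Z. card (F y \<times> F y))"
    by (simp add: card_cartesian_product power2_eq_square)
  also have "(\<Sum>y\<in>f ` Z. card (F y \<times> F y)) = card (SIGMA y:f ` Z. F y \<times> F y)"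
    using assms by (intro card_SigmaI[symmetric]) (auto simp: F_def)
  also have "\<dots> = card {(z, z'). z \<in> Z \<and> z' \<in> Z \<and> f z = f z'}"
    by (rule bij_betw_same_card[of snd]) (force simp: bij_betw_def inj_on_def F_def)
  finally have "real ((card Z)\<^sup>2)
      \<le> real (card (f ` Z) * card {(z, z'). z \<in> Z \<and> z' \<in> Z \<and> f z = f z'})"
    by (simp add: mult.commute)
  then show ?thesis unfolding of_nat_le_iff .
qed

text \<open>Exchange of summation. The weights used later are 1, \<open>2 * t\<close> and
  \<open>3 * t\<^sup>2\<close>, for first, second and third moments.\<close>

lemma sum_layer_cake:
  fixes f :: "'a \<Rightarrow> nat" and \<phi> :: "nat \<Rightarrow> real"
  assumes "finite W" and "\<And>w. w \<in> W \<Longrightarrow> f w \<le> n"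
  shows "(\<Sum>w\<in>W. \<Sum>t=1..f w. \<phi> t) = (\<Sum>t=1..n. \<phi> t * card {w \<in> W. t \<le> f w})"
proof -
  have "(\<Sum>w\<in>W. \<Sum>t=1..f w. \<phi> t) = (\<Sum>w\<in>W. \<Sum>t=1..n. if t \<le> f w then \<phi> t else 0)"
  proof (rule sum.cong[OF refl])
    fix w assume "w \<in> W"
    then have "{1..f w} = {t \<in> {1..n}. t \<le> f w}" using assms(2) by fastforce
    then show "(\<Sum>t=1..f w. \<phi> t) = (\<Sum>t=1..n. if t \<le> f w then \<phi> t else 0)"
      by (simp only:) (rule sum.inter_filter, simp)
  qed
  also have "\<dots> = (\<Sum>t=1..n. \<Sum>w\<in>W. if t \<le> f w then \<phi> t else 0)" by (rule sum.swap)
  also have "\<dots> = (\<Sum>t=1..n. \<phi> t * card {w \<in> W. t \<le> f w})"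
    using assms by (intro sum.cong) (simp_all add: sum.inter_filter[symmetric] mult.commute)
  finally show ?thesis .
qed

lemma square_le_sum: "(real n)\<^sup>2 \<le> (\<Sum>t=1..n. 2 * real t)"
  by (induction n) (auto simp: power2_eq_square algebra_simps)

lemma cube_le_sum: "real n ^ 3 \<le> (\<Sum>t=1..n. 3 * (real t)\<^sup>2)"
  by (induction n) (auto simp: power2_eq_square power3_eq_cube algebra_simps)

text \<open>For \<open>B\<close> without 0 this is the number of representations of \<open>r\<close>
  as a quotient of an element of \<open>B'\<close> by one of \<open>B\<close>; the denominator
  determines the numerator.\<close>

definition ratio_count :: "real set \<Rightarrow> real set \<Rightarrow> real \<Rightarrow> nat" where
  "ratio_count B B' r = card {a \<in> B. r * a \<in> B'}"

lemma sum_ratio_count_le: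
  assumes "finite R" "finite B" "finite B'" "0 \<notin> B"
  shows "(\<Sum>r\<in>R. ratio_count B B' r) \<le> card B * card B'"
proof -
  have "(\<Sum>r\<in>R. ratio_count B B' r) = card (SIGMA r:R. {a \<in> B. r * a \<in> B'})"
    unfolding ratio_count_def using assms by (intro card_SigmaI[symmetric]) auto
  also have "\<dots> \<le> card (B \<times> B')"
    using assms by (intro card_inj_on_le[where f = "\<lambda>(r, a). (a, r * a)"]) (auto simp: inj_on_def)
  finally show ?thesis by (simp add: card_cartesian_product)
qed

lemma finite_prod_set: "finite A \<Longrightarrow> finite (prod_set A)"
proof -
  have "prod_set A = (\<lambda>(a, b). a * b) ` (A \<times> A)" by (auto simp: prod_set_def)
  then show "finite A \<Longrightarrow> finite (prod_set A)" by simp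
qed

text \<open>The equations \<open>a\<^sub>1' / a\<^sub>1 = a\<^sub>2' / a\<^sub>2\<close> and
  \<open>a\<^sub>2 a\<^sub>1' = a\<^sub>1 a\<^sub>2'\<close> are equivalent, so ratios may be counted through products.\<close>

lemma sum_ratio_count_squared_ge:
  assumes A: "finite A" "0 \<notin> A" and B: "B \<subseteq> A" "B' \<subseteq> A" and R: "finite R"
    "\<And>a a'. a \<in> A \<Longrightarrow> a' \<in> A \<Longrightarrow> a' / a \<in> R"
  shows "(card B * card B')\<^sup>2 \<le> card (prod_set A) * (\<Sum>r\<in>R. (ratio_count B B' r)\<^sup>2)"
proof -
  let ?mul = "\<lambda>(a, b). a * b :: real"
  let ?C = "{(z, z'). z \<in> B \<times> B' \<and> z' \<in> B \<times> B' \<and> ?mul z = ?mul z'}"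
  define F where "F r = {a \<in> B. r * a \<in> B'}" for r
  have fin: "finite B" "finite B'" using A B finite_subset by blast+
  have "(card B * card B')\<^sup>2 \<le> card (?mul ` (B \<times> B')) * card ?C"
    using card_squared_le_collisions[of "B \<times> B'" ?mul] fin by (simp add: card_cartesian_product)
  also have "card (?mul ` (B \<times> B')) \<le> card (prod_set A)"
    using B by (intro card_mono finite_prod_set A) (auto simp: prod_set_def)
  also have "card ?C \<le> card (SIGMA r:R. F r \<times> F r)"
  proof (rule card_inj_on_le)
    \<comment> \<open>A collision is stored as the common ratio and the two denominators. The ratio
      gives back \<open>a1'\<close>, and the product equation then gives back
      \<open>a2'\<close>.\<close>
    let ?g = "\<lambda>((a2, a1'), (a1, a2')). (a1' / a1, (a1, a2)) :: real \<times> real \<times> real"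
    have nz: "a \<noteq> 0" if "a \<in> B" for a using that A B by auto
    show "inj_on ?g ?C"
    proof (rule inj_onI)
      fix u v assume uv: "u \<in> ?C" "v \<in> ?C" "?g u = ?g v"
      obtain a2 a1' a1 a2' b2 b1' b1 b2' where
        u: "u = ((a2, a1'), (a1, a2'))" and v: "v = ((b2, b1'), (b1, b2'))"
        by (metis surj_pair)
      from uv have *: "a1 = b1" "a2 = b2" "a1 \<noteq> 0" "a1' / a1 = b1' / b1"
        "a2 * a1' = a1 * a2'" "b2 * b1' = b1 * b2'"
        using nz unfolding u v by auto
      then have "a1' = b1'" by simp
      moreover from this * have "a2' = b2'" by (metis mult_left_cancel)
      ultimately show "u = v" using * u v by simp
    qed
    show "?g ` ?C \<subseteq> (SIGMA r:R. F r \<times> F r)"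
    proof clarsimp
      fix a2 a1' a1 a2' assume *: "a1 \<in> B" "a2 \<in> B" "a1' \<in> B'" "a2' \<in> B'" "a2 * a1' = a1 * a2'"
      then have "a1' / a1 * a2 = a2'" using nz by (simp add: field_simps)
      moreover have "a1' / a1 \<in> R" using * B R(2) by blast
      ultimately show "a1' / a1 \<in> R \<and> a1 \<in> F (a1' / a1) \<and> a2 \<in> F (a1' / a1)"
        using * nz by (auto simp: F_def)
    qed
    show "finite (SIGMA r:R. F r \<times> F r)" using fin R by (auto simp: F_def)
  qed
  also have "card (SIGMA r:R. F r \<times> F r) = (\<Sum>r\<in>R. card (F r \<times> F r))"
    using fin R by (intro card_SigmaI) (auto simp: F_def)
  also have "\<dots> = (\<Sum>r\<in>R. (ratio_count B B' r)\<^sup>2)"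
    by (simp add: card_cartesian_product power2_eq_square F_def ratio_count_def)
  finally show ?thesis by simp
qed

text \<open>The set \<open>A\<^sub>b\<close> of the overview. For \<open>Q = -A\<close> the
  condition says that \<open>a - b\<close> lies in \<open>A\<close>, so the fibre lists the
  representations of \<open>b\<close> as a difference.\<close>

definition fib :: "real set \<Rightarrow> real set \<Rightarrow> real \<Rightarrow> real set" where
  "fib Q A b = {a \<in> A. b - a \<in> Q}"

lemma fib_subset: "fib Q A b \<subseteq> A" by (auto simp: fib_def)

lemma finite_fib [simp]: "finite A \<Longrightarrow> finite (fib Q A b)" by (simp add: fib_def)

text \<open>The differences counted by \<open>ratio_count\<close> lie on the line of slope \<open>r\<close> through the point
  \<open>(b, b')\<close>, so each such line is rich in the grid \<open>Q \<times> Q\<close> and meets the grid \<open>P \<times> P\<close>.\<close>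

lemma card_rich_ratios_le:
  fixes t :: real
  assumes fin: "finite P" "finite Q" "finite A" "finite R" and PQ: "P \<noteq> {}" "card P \<le> card Q"
    and t: "8 \<le> t" and s: "s > 0" "s ^ 3 * real (card Q) ^ 4 = real (card P) ^ 4"
  shows "t\<^sup>2 * card {(b, b', r). b \<in> P \<and> b' \<in> P \<and> r \<in> R \<and> t \<le> ratio_count (fib Q A b) (fib Q A b') r}
    \<le> 1540 * (s * real (card Q) ^ 4 + real (card Q) ^ 4 / t)" (is "_ * real (card ?W) \<le> _")
proof (cases "?W = {}")
  case True
  have "0 \<le> 1540 * (s * real (card Q) ^ 4 + real (card Q) ^ 4 / t)" using s t by simp
  then show ?thesis by (simp only: True) simp
next
  case False
  define p q where "p = real (card P)" and "q = real (card Q)"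
  have pq: "1 \<le> p" "p \<le> q" using PQ fin by (auto simp: p_def q_def Suc_leI card_gt_0_iff)
  define L where "L = (\<lambda>(b, b', r). (r, b' - r * b)) ` ?W"
  have "?W \<subseteq> P \<times> P \<times> R" by auto
  then have finW: "finite ?W" by (rule finite_subset) (use fin in simp)
  then have finL: "finite L" by (simp add: L_def)
  have rich: "t \<le> card (line_pts Q l)" if "l \<in> L" for l
  proof -
    from that obtain b b' r where l: "l = (r, b' - r * b)"
      and r: "t \<le> ratio_count (fib Q A b) (fib Q A b') r"
      by (auto simp: L_def)
    have "ratio_count (fib Q A b) (fib Q A b') r \<le> card (line_pts Q l)"
      unfolding ratio_count_def
      by (rule card_inj_on_le[where f = "\<lambda>a. b - a"])
         (use fin in \<open>auto simp: inj_on_def l line_pts_def fib_def algebra_simps\<close>)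
    with r show ?thesis by linarith
  qed
  have cardL: "real (card L) \<le> 512 * q ^ 4 / t ^ 3"
    unfolding q_def using fin finL t rich by (intro rich_lines_le) auto
  have "card ?W \<le> card (SIGMA l:L. line_pts P l)"
  \<comment> \<open>A triple is recovered from its line and \<open>b\<close>, because
    \<open>b'\<close> is the height of the line at \<open>b\<close>.\<close>
  proof (rule card_inj_on_le[where f = "\<lambda>(b, b', r). ((r, b' - r * b), b)"])
    show "(\<lambda>(b, b', r). ((r, b' - r * b), b)) ` ?W \<subseteq> (SIGMA l:L. line_pts P l)"
      by (force simp: L_def line_pts_def)
    show "finite (SIGMA l:L. line_pts P l)" using finL fin by auto
  qed (auto simp: inj_on_def)
  also have "\<dots> = (\<Sum>l\<in>L. card (line_pts P l))" using finL fin by (intro card_SigmaI) auto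
  finally have "card ?W \<le> (\<Sum>l\<in>L. card (line_pts P l))" .
  from of_nat_mono[OF this, where ?'a = real]
  have inc: "card ?W \<le> (\<Sum>l\<in>L. real (card (line_pts P l)))" by (simp only: of_nat_sum)
  have W_le: "card ?W \<le> 1536 * (\<rho> * (q ^ 4 / t ^ 3)) + 4 * p ^ 4 / \<rho>\<^sup>2" if "1 \<le> \<rho>" "\<rho> \<le> p" for \<rho>
  proof -
    have "card ?W \<le> 3 * \<rho> * card L + 4 * p ^ 4 / \<rho>\<^sup>2"
      using inc incidences_le_real[of P L \<rho>] fin finL that unfolding p_def by linarith
    also have "3 * \<rho> * card L \<le> 3 * \<rho> * (512 * q ^ 4 / t ^ 3)"
      using cardL that by (intro mult_left_mono) auto
    finally show ?thesis by (simp add: algebra_simps)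
  qed
  have sq: "s ^ 3 * q ^ 4 = p ^ 4" using s by (simp add: p_def q_def)
  show ?thesis
  \<comment> \<open>Here \<open>s\<close> is \<open>(p / q)\<close> to the power 4/3, and
    \<open>\<rho> = t * s\<close> balances the two terms of \<open>W_le\<close>. If this is below 1,
    the choice is \<open>\<rho> = 1\<close>. The constant is 1540 = 3 * 512 + 4.\<close>
  proof (cases "1 \<le> t * s")
    case True
    \<comment> \<open>Admissibility of \<open>\<rho> = t * s\<close>, that is
      \<open>t * s \<le> p\<close>: from \<open>p \<le> q\<close> follows
      \<open>s * q \<le> p\<close>, and a rich line forces \<open>t \<le> q\<close>.\<close>
    have "(s * q) ^ 3 * q = p ^ 3 * p" using sq by (simp add: power3_eq_cube power4_eq_xxxx mult_ac)
    also have "\<dots> \<le> p ^ 3 * q" using pq by (intro mult_left_mono) auto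
    finally have "(s * q) ^ 3 \<le> p ^ 3" by (rule mult_right_le_imp_le) (use pq in linarith)
    then have "s * q \<le> p" using power_strict_mono[of p "s * q" 3] pq by linarith
    moreover have "t \<le> q"
    proof -
      from False have "L \<noteq> {}" unfolding L_def image_is_empty .
      then obtain l where "l \<in> L" by blast
      moreover have "card (line_pts Q l) \<le> card Q"
        by (rule card_mono) (use fin in \<open>auto simp: line_pts_def\<close>)
      ultimately show ?thesis using rich[of l] unfolding q_def by linarith
    qed
    then have "t * s \<le> q * s" using s by (intro mult_right_mono) auto
    ultimately have "t * s \<le> p" by (simp add: mult.commute)
    from W_le[OF True this]
    have "card ?W \<le> 1536 * (t * s * (q ^ 4 / t ^ 3)) + 4 * (s ^ 3 * q ^ 4) / (t * s)\<^sup>2"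
      unfolding sq .
    also have "t * s * (q ^ 4 / t ^ 3) = s * q ^ 4 / t\<^sup>2"
      using t by (simp add: power2_eq_square power3_eq_cube)
    also have "4 * (s ^ 3 * q ^ 4) / (t * s)\<^sup>2 = 4 * (s * q ^ 4 / t\<^sup>2)"
      using s t by (simp add: power2_eq_square power3_eq_cube)
    finally have "card ?W \<le> 1540 * (s * q ^ 4) / t\<^sup>2" by simp
    then have "t\<^sup>2 * card ?W \<le> 1540 * (s * q ^ 4)" using t by (simp add: pos_le_divide_eq mult.commute)
    also have "\<dots> \<le> 1540 * (s * q ^ 4 + q ^ 4 / t)" using pq t by simp
    finally show ?thesis by (simp add: q_def)
  next
    case False
    \<comment> \<open>Now \<open>p ^ 4 = s ^ 3 * q ^ 4\<close> is at most
      \<open>q ^ 4 / t ^ 3\<close>, so the second term of \<open>W_le\<close> merges into the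
      first.\<close>
    have "(t * s) ^ 3 \<le> 1 ^ 3" using False s t by (intro power_mono) auto
    then have "s ^ 3 \<le> 1 / t ^ 3"
      using t by (simp add: pos_le_divide_eq power_mult_distrib mult.commute)
    then have "s ^ 3 * q ^ 4 \<le> 1 / t ^ 3 * q ^ 4" by (rule mult_right_mono) simp
    then have "card ?W \<le> 1540 * (q ^ 4 / t ^ 3)" using W_le[of 1] pq sq by simp
    then have "t\<^sup>2 * card ?W \<le> t\<^sup>2 * (1540 * (q ^ 4 / t ^ 3))" by (intro mult_left_mono) auto
    also have "\<dots> = 1540 * (q ^ 4 / t)" using t by (simp add: power2_eq_square power3_eq_cube)
    also have "\<dots> \<le> 1540 * (s * q ^ 4 + q ^ 4 / t)" using s pq by simp
    finally show ?thesis by (simp add: q_def)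
  qed
qed

text \<open>The choice \<open>t = S / (4 * G)\<close> makes the first term equal to
  \<open>S / 2\<close>. Either this \<open>t\<close> is below 8, or one of the other two terms is at
  least \<open>S / 4\<close>.\<close>

lemma threshold_trichotomy:
  fixes S G K M q :: real
  assumes bound: "\<And>t. 8 \<le> t \<Longrightarrow> S \<le> 2 * t * G + K * (M + q / t)" and "G > 0"
  shows "S \<le> 32 * G \<or> S \<le> 4 * K * M \<or> S\<^sup>2 \<le> 16 * K * q * G"
proof (rule ccontr)
  assume "\<not> ?thesis"
  then have *: "32 * G < S" "4 * K * M < S" "16 * K * q * G < S * S"
    by (auto simp: power2_eq_square)
  define t where "t = S / (4 * G)"
  have "8 \<le> t" using * \<open>G > 0\<close> by (simp add: t_def pos_le_divide_eq)
  from bound[OF this] have "S \<le> S / 2 + K * M + K * (q / t)"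
    using \<open>G > 0\<close> by (simp add: t_def algebra_simps)
  moreover have "K * (q / t) < S / 4"
  proof -
    have "K * (q / t) = (4 * K * q * G) / S" using \<open>G > 0\<close> by (simp add: t_def)
    also have "\<dots> < S / 4" using * \<open>G > 0\<close> by (simp add: pos_divide_less_eq)
    finally show ?thesis .
  qed
  ultimately show False using *(2) by linarith
qed

section \<open>Ratio energies summed over all pairs of fibres\<close>

context
  fixes P Q A R :: "real set" and F :: "real \<times> real \<times> real \<Rightarrow> nat"
    and g :: real
  defines "R \<equiv> (\<lambda>(a, a'). a' / a) ` (A \<times> A)"
    and "F \<equiv> \<lambda>(b, b', r). ratio_count (fib Q A b) (fib Q A b') r"
    and "g \<equiv> (\<Sum>b\<in>P. real (card (fib Q A b)))"
  assumes fin: "finite P" "finite Q" "finite A" and A0: "0 \<notin> A"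
begin

text \<open>Cauchy-Schwarz over \<open>P\<close>, squared, produces the products of squared fibre
  sizes; each is bounded by \<open>card (prod_set A)\<close> times an energy.\<close>

lemma sum_squares_ge:
  "g ^ 4 \<le> (real (card P))\<^sup>2 * (card (prod_set A) * (\<Sum>w\<in>P \<times> P \<times> R. (real (F w))\<^sup>2))"
proof -
  let ?a = "\<lambda>b. real (card (fib Q A b))"
  have R: "finite R" "\<And>a a'. a \<in> A \<Longrightarrow> a' \<in> A \<Longrightarrow> a' / a \<in> R"
    using fin by (auto simp: R_def)
  have step: "(?a b)\<^sup>2 * (?a b')\<^sup>2 \<le> card (prod_set A) * (\<Sum>r\<in>R. (real (F (b, b', r)))\<^sup>2)" for b b'
  proof -
    have "real ((card (fib Q A b) * card (fib Q A b'))\<^sup>2)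
        \<le> real (card (prod_set A) * (\<Sum>r\<in>R. (ratio_count (fib Q A b) (fib Q A b') r)\<^sup>2))"
      unfolding of_nat_le_iff
      by (rule sum_ratio_count_squared_ge) (use fin A0 R fib_subset in auto)
    then show ?thesis by (simp add: F_def power_mult_distrib)
  qed
  have "g ^ 4 = (g\<^sup>2)\<^sup>2" by simp
  also have "\<dots> \<le> ((\<Sum>b\<in>P. (?a b)\<^sup>2) * card P)\<^sup>2"
    unfolding g_def by (intro power_mono sum_squared_le_sum_of_squares) auto
  also have "\<dots> = (real (card P))\<^sup>2 * (\<Sum>b\<in>P. \<Sum>b'\<in>P. (?a b)\<^sup>2 * (?a b')\<^sup>2)"
    unfolding power_mult_distrib by (simp add: power2_eq_square sum_product)
  also have "(\<Sum>b\<in>P. \<Sum>b'\<in>P. (?a b)\<^sup>2 * (?a b')\<^sup>2)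
      \<le> (\<Sum>b\<in>P. \<Sum>b'\<in>P. card (prod_set A) * (\<Sum>r\<in>R. (real (F (b, b', r)))\<^sup>2))"
    by (intro sum_mono step)
  also have "\<dots> = card (prod_set A) * (\<Sum>w\<in>P \<times> P \<times> R. (real (F w))\<^sup>2)"
    by (simp only: sum_distrib_left sum.cartesian_product')
  finally show ?thesis by (simp add: mult_left_mono)
qed

lemma sum_le: "(\<Sum>w\<in>P \<times> P \<times> R. real (F w)) \<le> g\<^sup>2"
proof -
  have "finite R" using fin by (simp add: R_def)
  then have "(\<Sum>r\<in>R. F (b, b', r)) \<le> card (fib Q A b) * card (fib Q A b')" for b b'
    unfolding F_def prod.case by (rule sum_ratio_count_le) (use fin A0 in \<open>auto simp: fib_def\<close>)
  then have "(\<Sum>b\<in>P. \<Sum>b'\<in>P. \<Sum>r\<in>R. F (b, b', r))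
      \<le> (\<Sum>b\<in>P. \<Sum>b'\<in>P. card (fib Q A b) * card (fib Q A b'))"
    by (intro sum_mono)
  then have "(\<Sum>w\<in>P \<times> P \<times> R. F w) \<le> (\<Sum>b\<in>P. card (fib Q A b))\<^sup>2"
    by (simp only: sum.cartesian_product' power2_eq_square sum_product)
  from of_nat_mono[OF this, where ?'a = real] show ?thesis
    by (simp only: of_nat_sum of_nat_power g_def)
qed

text \<open>The second moment is split at level \<open>T\<close>. Levels up to \<open>T\<close> are
  paid for by the first moment \<open>sum_le\<close>; on higher levels the rich-ratio bound leaves
  \<open>1 / t\<close>, which sums to a harmonic number.\<close>

lemma sum_squares_le:
  fixes s T :: real
  assumes PQ: "P \<noteq> {}" "card P \<le> card Q"
    and s: "s > 0" "s ^ 3 * real (card Q) ^ 4 = real (card P) ^ 4" and T: "8 \<le> T"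
  shows "(\<Sum>w\<in>P \<times> P \<times> R. (real (F w))\<^sup>2)
    \<le> 2 * T * g\<^sup>2 + 3080 * harm (card A) * (s * real (card Q) ^ 4 + real (card Q) ^ 4 / T)"
proof -
  define W where "W t = {w \<in> P \<times> P \<times> R. t \<le> F w}" for t
  define Z where "Z = s * real (card Q) ^ 4 + real (card Q) ^ 4 / T"
  have "finite R" using fin by (simp add: R_def)
  then have finW: "finite (P \<times> P \<times> R)" using fin by simp
  have F_le: "F w \<le> card A" if "w \<in> P \<times> P \<times> R" for w
    unfolding F_def ratio_count_def
    by (cases w) (auto intro!: card_mono fin simp: fib_def)
  have "0 \<le> Z" using s T by (simp add: Z_def)
  have rich: "real t * card (W t) \<le> 1540 * Z * (1 / real t)" if "T \<le> t" for t
  proof -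
    have W_eq: "W t = {(b, b', r). b \<in> P \<and> b' \<in> P \<and> r \<in> R
        \<and> real t \<le> ratio_count (fib Q A b) (fib Q A b') r}"
      by (auto simp: W_def F_def)
    have "(real t)\<^sup>2 * card (W t) \<le> 1540 * (s * real (card Q) ^ 4 + real (card Q) ^ 4 / real t)"
      unfolding W_eq using that T s PQ fin \<open>finite R\<close> by (intro card_rich_ratios_le) auto
    also have "\<dots> \<le> 1540 * Z"
      unfolding Z_def using that T by (intro mult_left_mono add_left_mono divide_left_mono) auto
    finally have "real t * (real t * card (W t)) \<le> 1540 * Z" by (simp add: power2_eq_square mult_ac)
    then show ?thesis using that T by (simp add: pos_le_divide_eq mult_ac)
  qed
  have "(\<Sum>w\<in>P \<times> P \<times> R. (real (F w))\<^sup>2) \<le> (\<Sum>w\<in>P \<times> P \<times> R. \<Sum>t=1..F w. 2 * real t)"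
    by (intro sum_mono square_le_sum)
  also have "\<dots> = (\<Sum>t=1..card A. 2 * real t * card (W t))"
    unfolding W_def by (rule sum_layer_cake) (use finW F_le in auto)
  also have "\<dots> \<le> (\<Sum>t=1..card A. 2 * T * card (W t) + 3080 * Z * (1 / real t))"
  proof (rule sum_mono)
    fix t :: nat
    have "0 \<le> 1540 * Z * (1 / real t)" "0 \<le> T * card (W t)" using \<open>0 \<le> Z\<close> T by simp_all
    moreover have "real t * card (W t) \<le> T * card (W t)" if "t \<le> T"
      using that by (rule mult_right_mono) simp
    ultimately show "2 * real t * card (W t) \<le> 2 * T * card (W t) + 3080 * Z * (1 / real t)"
      using rich[of t] by (cases "T \<le> t") linarith+
  qed
  also have "\<dots> = 2 * T * (\<Sum>t=1..card A. 1 * real (card (W t))) + 3080 * Z * harm (card A)"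
    by (simp add: sum.distrib sum_distrib_left harm_def divide_inverse)
  also have "(\<Sum>t=1..card A. 1 * real (card (W t))) = (\<Sum>w\<in>P \<times> P \<times> R. \<Sum>t=1..F w. 1)"
    unfolding W_def by (rule sum_layer_cake[symmetric]) (use finW F_le in auto)
  also have "2 * T * (\<Sum>w\<in>P \<times> P \<times> R. \<Sum>t=1..F w. 1) \<le> 2 * T * g\<^sup>2"
    using sum_le T by (intro mult_left_mono) auto
  finally show ?thesis by (simp add: Z_def mult_ac)
qed

text \<open>Upper and lower bounds for the energy sum are compared at the best threshold. The
  constant is 49280 = 16 * 3080.\<close>

lemma fib_sum_trichotomy:
  assumes PQ: "P \<noteq> {}" "card P \<le> card Q" and g: "g > 0"
  shows "g\<^sup>2 \<le> 32 * (real (card P))\<^sup>2 * card (prod_set A)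
    \<or> g ^ 6 \<le> 49280 * harm (card A) * (real (card (prod_set A)))\<^sup>2 * real (card P) ^ 4 * real (card Q) ^ 4
    \<or> g ^ 12 \<le> (49280 * harm (card A) * card (prod_set A)) ^ 3 * real (card P) ^ 10 * real (card Q) ^ 8"
proof -
  define p q m H where "p = real (card P)" and "q = real (card Q)"
    and "m = real (card (prod_set A))" and "H = (harm (card A) :: real)"
  define S where "S = (\<Sum>w\<in>P \<times> P \<times> R. (real (F w))\<^sup>2)"
  define s where "s = root 3 (p ^ 4 / q ^ 4)"
  have pq: "p > 0" "q > 0" using PQ fin by (auto simp: p_def q_def card_gt_0_iff)
  have s: "s > 0" "s ^ 3 * q ^ 4 = p ^ 4" using pq by (auto simp: s_def)
  have nonneg: "0 \<le> m" "0 \<le> H" "0 \<le> S" by (auto simp: m_def H_def S_def harm_nonneg intro: sum_nonneg)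
  have lower: "g ^ 4 \<le> p\<^sup>2 * (m * S)" using sum_squares_ge by (simp add: p_def m_def S_def)
  have "S \<le> 2 * t * g\<^sup>2 + 3080 * H * (s * q ^ 4 + q ^ 4 / t)" if "8 \<le> t" for t
    using sum_squares_le[OF PQ _ _ that, of s] s by (simp add: S_def H_def q_def p_def)
  then consider "S \<le> 32 * g\<^sup>2" | "S \<le> 4 * (3080 * H) * (s * q ^ 4)"
    | "S\<^sup>2 \<le> 16 * (3080 * H) * q ^ 4 * g\<^sup>2"
    using threshold_trichotomy[of S "g\<^sup>2" "3080 * H" "s * q ^ 4" "q ^ 4"] g by auto
  then have "g\<^sup>2 \<le> 32 * p\<^sup>2 * m \<or> g ^ 6 \<le> 49280 * H * m\<^sup>2 * p ^ 4 * q ^ 4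
      \<or> g ^ 12 \<le> (49280 * H * m) ^ 3 * p ^ 10 * q ^ 8"
  proof cases
    case 1
    then have "p\<^sup>2 * (m * S) \<le> p\<^sup>2 * (m * (32 * g\<^sup>2))"
      using nonneg by (intro mult_left_mono) auto
    with lower have "g\<^sup>2 * g\<^sup>2 \<le> 32 * p\<^sup>2 * m * g\<^sup>2" by (simp add: mult_ac flip: power_add)
    then have "g\<^sup>2 \<le> 32 * p\<^sup>2 * m" by (rule mult_right_le_imp_le) (use g in simp)
    then show ?thesis ..
  next
    case 2
    have "p\<^sup>2 * (m * S) \<le> p\<^sup>2 * (m * (4 * (3080 * H) * (s * q ^ 4)))"
      using nonneg 2 by (intro mult_left_mono) auto
    with lower have "g ^ 4 \<le> 12320 * (p\<^sup>2 * m * H * (s * q ^ 4))" by (simp add: mult_ac)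
    \<comment> \<open>The constant is enlarged to agree with the other case; cubing then eliminates
      \<open>s\<close> through \<open>s ^ 3 * q ^ 4 = p ^ 4\<close>.\<close>
    also have "\<dots> \<le> 49280 * (p\<^sup>2 * m * H * (s * q ^ 4))"
      using nonneg s pq by (intro mult_right_mono mult_nonneg_nonneg) auto
    finally have "(g ^ 4) ^ 3 \<le> (49280 * (p\<^sup>2 * m * H * (s * q ^ 4))) ^ 3"
      by (rule power_mono) simp
    also have "\<dots> = (49280 * H * m) ^ 3 * p ^ 6 * (s ^ 3 * q ^ 4) * q ^ 8"
      by (simp add: power_mult_distrib mult_ac flip: power_mult power_add)
    also have "\<dots> = (49280 * H * m) ^ 3 * p ^ 10 * q ^ 8"
      unfolding s(2) by (simp add: mult_ac flip: power_add)
    finally show ?thesis by (simp flip: power_mult)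
  next
    case 3
    have "(g ^ 4)\<^sup>2 \<le> (p\<^sup>2 * (m * S))\<^sup>2" using lower by (rule power_mono) simp
    also have "\<dots> = p ^ 4 * m\<^sup>2 * S\<^sup>2" by (simp add: power_mult_distrib mult_ac flip: power_mult)
    also have "\<dots> \<le> p ^ 4 * m\<^sup>2 * (16 * (3080 * H) * q ^ 4 * g\<^sup>2)"
      using 3 by (intro mult_left_mono) auto
    finally have "g ^ 6 * g\<^sup>2 \<le> (49280 * H * m\<^sup>2 * p ^ 4 * q ^ 4) * g\<^sup>2"
      by (simp add: mult_ac flip: power_mult power_add)
    then have "g ^ 6 \<le> 49280 * H * m\<^sup>2 * p ^ 4 * q ^ 4"
      by (rule mult_right_le_imp_le) (use g in simp)
    then show ?thesis by blast
  qed
  then show ?thesis by (simp add: p_def q_def m_def H_def)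
qed

end

section \<open>Popular differences\<close>

text \<open>The hypothesis bounds \<open>d\<^sup>2 * \<tau> ^ 6\<close>. The square of the goal is
  the cube of that bound times the square of the trivial bound
  \<open>d * \<tau> ^ 3 \<le> n ^ 4\<close>.\<close>

lemma middle_case_algebra:
  fixes d \<tau> n m k :: real
  assumes "0 < d" "0 < \<tau>" "\<tau> \<le> n" "d * \<tau> \<le> n\<^sup>2" "0 \<le> m" "1 \<le> k"
    and le: "(d * \<tau>) ^ 6 \<le> k * m\<^sup>2 * d ^ 4 * n ^ 4"
  shows "(d * \<tau> ^ 3) ^ 4 \<le> k ^ 3 * m ^ 3 * n ^ 10"
proof -
  have "d * \<tau> ^ 3 = d * \<tau> * \<tau>\<^sup>2" by (simp add: power2_eq_square power3_eq_cube)
  also have "\<dots> \<le> n\<^sup>2 * n\<^sup>2" using assms by (intro mult_mono power_mono) auto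
  finally have small: "d * \<tau> ^ 3 \<le> n ^ 4" by (simp flip: power_add)
  have "(d\<^sup>2 * \<tau> ^ 6) * d ^ 4 = (d * \<tau>) ^ 6" by algebra
  with le have "(d\<^sup>2 * \<tau> ^ 6) * d ^ 4 \<le> (k * m\<^sup>2 * n ^ 4) * d ^ 4" by (simp only: mult_ac)
  then have cancel: "d\<^sup>2 * \<tau> ^ 6 \<le> k * m\<^sup>2 * n ^ 4"
    by (rule mult_right_le_imp_le) (use assms in simp)
  have "((d * \<tau> ^ 3) ^ 4)\<^sup>2 = (d\<^sup>2 * \<tau> ^ 6) ^ 3 * (d * \<tau> ^ 3)\<^sup>2"
    by (simp add: power_mult_distrib mult_ac flip: power_add power_mult)
  also have "\<dots> \<le> (k * m\<^sup>2 * n ^ 4) ^ 3 * (n ^ 4)\<^sup>2"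
    using assms by (intro mult_mono[OF power_mono[OF cancel] power_mono[OF small]]) auto
  also have "\<dots> = k ^ 3 * (m ^ 6 * n ^ 20)"
    by (simp add: power_mult_distrib mult_ac flip: power_add power_mult)
  also have "\<dots> \<le> k ^ 6 * (m ^ 6 * n ^ 20)"
    using assms by (intro mult_right_mono power_increasing) auto
  also have "\<dots> = (k ^ 3 * m ^ 3 * n ^ 10)\<^sup>2"
    by (simp add: power_mult_distrib flip: power_mult)
  finally show ?thesis by (rule power2_le_imp_le) (use assms in simp)
qed

text \<open>The case \<open>P = A\<close>, \<open>Q = D\<close>. The last alternative gives the goal
  exactly after cancelling \<open>d ^ 8\<close>; the first loses through
  \<open>\<tau> \<le> d\<close> and \<open>\<tau> \<le> n\<close>.\<close>

lemma trichotomy_algebra_A: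
  fixes d \<tau> n m k :: real
  assumes d: "n \<le> d" "0 < n" and \<tau>: "0 < \<tau>" "\<tau> \<le> n" "d * \<tau> \<le> n\<^sup>2" and m: "0 \<le> m" and k: "32 \<le> k"
    and cases: "(d * \<tau>)\<^sup>2 \<le> 32 * n\<^sup>2 * m \<or> (d * \<tau>) ^ 6 \<le> k * m\<^sup>2 * n ^ 4 * d ^ 4
      \<or> (d * \<tau>) ^ 12 \<le> (k * m) ^ 3 * n ^ 10 * d ^ 8"
  shows "(d * \<tau> ^ 3) ^ 4 \<le> k ^ 3 * m ^ 3 * n ^ 10"
  using cases
proof (elim disjE)
  assume *: "(d * \<tau>)\<^sup>2 \<le> 32 * n\<^sup>2 * m"
  have "(d * \<tau> ^ 3) ^ 4 = (d ^ 4 * \<tau> ^ 6) * (\<tau>\<^sup>2 * \<tau> ^ 4)"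
    by (simp add: power_mult_distrib mult_ac flip: power_add power_mult)
  also have "\<dots> \<le> (d ^ 4 * \<tau> ^ 6) * (d\<^sup>2 * n ^ 4)"
    using d \<tau> by (intro mult_left_mono mult_mono power_mono) auto
  also have "\<dots> = ((d * \<tau>)\<^sup>2) ^ 3 * n ^ 4"
    by (simp add: power_mult_distrib mult_ac flip: power_add power_mult)
  also have "\<dots> \<le> (32 * n\<^sup>2 * m) ^ 3 * n ^ 4"
    using * by (intro mult_right_mono power_mono) auto
  also have "\<dots> \<le> (k * n\<^sup>2 * m) ^ 3 * n ^ 4"
    using k m d by (intro mult_right_mono power_mono) auto
  also have "\<dots> = k ^ 3 * m ^ 3 * n ^ 10"
    by (simp add: power_mult_distrib mult_ac flip: power_add power_mult)
  finally show ?thesis .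
next
  assume "(d * \<tau>) ^ 6 \<le> k * m\<^sup>2 * n ^ 4 * d ^ 4"
  then show ?thesis using d \<tau> m k by (intro middle_case_algebra) (auto simp: mult_ac)
next
  assume "(d * \<tau>) ^ 12 \<le> (k * m) ^ 3 * n ^ 10 * d ^ 8"
  moreover have "(d * \<tau> ^ 3) ^ 4 * d ^ 8 = (d * \<tau>) ^ 12" by algebra
  ultimately have "(d * \<tau> ^ 3) ^ 4 * d ^ 8 \<le> (k ^ 3 * m ^ 3 * n ^ 10) * d ^ 8"
    by (simp only: power_mult_distrib)
  then show ?thesis by (rule mult_right_le_imp_le) (use d in simp)
qed

text \<open>The case \<open>P = D\<close>, \<open>Q = -A\<close>. Cancelling powers of
  \<open>d\<close> leaves a few factors \<open>d\<close>, which are raised to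
  \<open>n\<close>.\<close>

lemma trichotomy_algebra_D:
  fixes d \<tau> n m k :: real
  assumes d: "d \<le> n" "0 < d" and \<tau>: "0 < \<tau>" "\<tau> \<le> n" and m: "0 \<le> m" and k: "32 \<le> k"
    and cases: "(d * \<tau>)\<^sup>2 \<le> 32 * d\<^sup>2 * m \<or> (d * \<tau>) ^ 6 \<le> k * m\<^sup>2 * d ^ 4 * n ^ 4
      \<or> (d * \<tau>) ^ 12 \<le> (k * m) ^ 3 * d ^ 10 * n ^ 8"
  shows "(d * \<tau> ^ 3) ^ 4 \<le> k ^ 3 * m ^ 3 * n ^ 10"
  using cases
proof (elim disjE)
  assume "(d * \<tau>)\<^sup>2 \<le> 32 * d\<^sup>2 * m"
  then have "\<tau>\<^sup>2 * d\<^sup>2 \<le> (32 * m) * d\<^sup>2" by (simp add: power_mult_distrib mult_ac)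
  then have "\<tau>\<^sup>2 \<le> 32 * m" by (rule mult_right_le_imp_le) (use d in simp)
  also have "\<dots> \<le> k * m" using k m by (rule mult_right_mono)
  finally have *: "\<tau>\<^sup>2 \<le> k * m" .
  have "(d * \<tau> ^ 3) ^ 4 = (\<tau>\<^sup>2) ^ 3 * (d ^ 4 * \<tau> ^ 6)"
    by (simp add: power_mult_distrib mult_ac flip: power_add power_mult)
  also have "\<dots> \<le> (k * m) ^ 3 * (n ^ 4 * n ^ 6)"
    using d \<tau> * k m by (intro mult_mono power_mono) auto
  also have "\<dots> = k ^ 3 * m ^ 3 * n ^ 10"
    by (simp add: power_mult_distrib mult_ac flip: power_add)
  finally show ?thesis .
next
  assume "(d * \<tau>) ^ 6 \<le> k * m\<^sup>2 * d ^ 4 * n ^ 4"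
  moreover have "d * \<tau> \<le> n\<^sup>2" unfolding power2_eq_square using d \<tau> by (intro mult_mono) auto
  ultimately show ?thesis using d \<tau> m k by (intro middle_case_algebra) auto
next
  assume "(d * \<tau>) ^ 12 \<le> (k * m) ^ 3 * d ^ 10 * n ^ 8"
  moreover have "(d\<^sup>2 * \<tau> ^ 12) * d ^ 10 = (d * \<tau>) ^ 12" by algebra
  ultimately have "(d\<^sup>2 * \<tau> ^ 12) * d ^ 10 \<le> (k ^ 3 * m ^ 3 * n ^ 8) * d ^ 10"
    by (simp only: power_mult_distrib mult_ac)
  then have "d\<^sup>2 * \<tau> ^ 12 \<le> k ^ 3 * m ^ 3 * n ^ 8" by (rule mult_right_le_imp_le) (use d in simp)
  then have "(d\<^sup>2 * \<tau> ^ 12) * d\<^sup>2 \<le> (k ^ 3 * m ^ 3 * n ^ 8) * n\<^sup>2"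
    using d m k by (intro mult_mono[OF _ power_mono[OF d(1)]]) auto
  moreover have "(d\<^sup>2 * \<tau> ^ 12) * d\<^sup>2 = (d * \<tau> ^ 3) ^ 4"
    "(k ^ 3 * m ^ 3 * n ^ 8) * n\<^sup>2 = k ^ 3 * m ^ 3 * n ^ 10" by algebra+
  ultimately show ?thesis by (simp only:)
qed

section \<open>Representation counts and a single popularity level\<close>

lemma rdiff_le_card:
  assumes "finite A"
  shows "rdiff A x \<le> card A"
  unfolding rdiff_def using assms
  by (intro card_inj_on_le[where f = fst]) (auto simp: inj_on_def)

lemma finite_diff_set: "finite A \<Longrightarrow> finite (diff_set A)"
proof -
  have "diff_set A = (\<lambda>(a, b). a - b) ` (A \<times> A)" by (auto simp: diff_set_def)
  then show "finite A \<Longrightarrow> finite (diff_set A)" by simp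
qed

text \<open>Double counting of pairs in \<open>A\<close> with difference in \<open>D\<close>: by
  difference, and by first entry.\<close>

lemma sum_rdiff_le_sum_fib:
  assumes "finite A" "finite D"
  shows "(\<Sum>x\<in>D. rdiff A x) \<le> (\<Sum>b\<in>A. card (fib D A b))"
proof -
  let ?r = "\<lambda>x. {(a, b). a \<in> A \<and> b \<in> A \<and> a - b = x}"
  have fin: "finite (?r x)" for x
    by (rule finite_subset[of _ "A \<times> A"]) (use assms in auto)
  have "(\<Sum>x\<in>D. rdiff A x) = card (SIGMA x:D. ?r x)"
    unfolding rdiff_def using assms fin by (intro card_SigmaI[symmetric]) auto
  also have "\<dots> \<le> card (SIGMA b:A. fib D A b)"
    by (rule card_inj_on_le[where f = snd]) (use assms in \<open>auto simp: inj_on_def fib_def\<close>)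
  also have "\<dots> = (\<Sum>b\<in>A. card (fib D A b))" using assms by (intro card_SigmaI) auto
  finally show ?thesis .
qed

lemma rdiff_le_card_fib:
  assumes "finite A"
  shows "rdiff A x \<le> card (fib (uminus ` A) A x)"
  unfolding rdiff_def
  by (rule card_inj_on_le[where f = fst]) (use assms in \<open>auto simp: inj_on_def fib_def\<close>)

lemma harm_ge_1: "n > 0 \<Longrightarrow> harm n \<ge> (1 :: real)"
  using harm_mono[of 1 n] by (simp add: harm_expand)

text \<open>The trichotomy asks for the smaller set as \<open>P\<close>, so the comparison of
  \<open>card A\<close> with \<open>card D\<close> assigns the roles. Both assignments end in the
  same bound.\<close>

lemma card_popular_differences_le:
  fixes \<tau> :: nat
  assumes A: "finite A" "0 \<notin> A" and \<tau>: "\<tau> > 0"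
  defines "D \<equiv> {x \<in> diff_set A. \<tau> \<le> rdiff A x}"
  shows "(real (card D) * real \<tau> ^ 3) ^ 4
    \<le> (49280 * harm (card A)) ^ 3 * real (card (prod_set A)) ^ 3 * real (card A) ^ 10"
proof (cases "D = {}")
  case False
  define d n m k where "d = real (card D)" and "n = real (card A)"
    and "m = real (card (prod_set A))" and "k = 49280 * (harm (card A) :: real)"
  have finD: "finite D" using finite_diff_set A by (simp add: D_def)
  from False obtain x where x: "x \<in> D" by blast
  then have "\<tau> \<le> card A" using rdiff_le_card[OF A(1), of x] by (simp add: D_def)
  then have \<tau>n: "real \<tau> \<le> n" "0 < n" and k: "32 \<le> k"
    using \<tau> harm_ge_1[of "card A"] by (auto simp: n_def k_def)
  have m: "0 \<le> m" by (simp add: m_def)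
  have d: "0 < d" using False finD by (simp add: d_def card_gt_0_iff)
  have sum_ge: "d * \<tau> \<le> (\<Sum>x\<in>D. real (rdiff A x))"
    using sum_mono[of D "\<lambda>_. real \<tau>" "\<lambda>x. real (rdiff A x)"] by (simp add: D_def d_def)
  have pos: "0 < d * \<tau>" using d \<tau> by simp
  show ?thesis
  proof (cases "card A \<le> card D")
    case True
    define g where "g = (\<Sum>b\<in>A. real (card (fib D A b)))"
    have "d * \<tau> \<le> g"
      using sum_ge of_nat_mono[OF sum_rdiff_le_sum_fib[OF A(1) finD], where ?'a = real]
      by (simp add: g_def)
    moreover have "g \<le> (\<Sum>b\<in>A. n)"
      unfolding g_def n_def by (intro sum_mono of_nat_mono card_mono A fib_subset)
    ultimately have g: "0 \<le> d * \<tau>" "d * \<tau> \<le> g" "0 < g" "d * \<tau> \<le> n\<^sup>2"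
      using pos by (auto simp: n_def power2_eq_square)
    have "g\<^sup>2 \<le> 32 * n\<^sup>2 * m \<or> g ^ 6 \<le> k * m\<^sup>2 * n ^ 4 * d ^ 4
        \<or> g ^ 12 \<le> (k * m) ^ 3 * n ^ 10 * d ^ 8"
      using fib_sum_trichotomy[of A D A] A finD True g(3) \<tau>n
      unfolding g_def n_def m_def k_def d_def by fastforce
    \<comment> \<open>In each alternative \<open>g\<close> occurs only on the left, so it may be
      lowered to \<open>d * \<tau>\<close>.\<close>
    then have "(d * \<tau>)\<^sup>2 \<le> 32 * n\<^sup>2 * m \<or> (d * \<tau>) ^ 6 \<le> k * m\<^sup>2 * n ^ 4 * d ^ 4
        \<or> (d * \<tau>) ^ 12 \<le> (k * m) ^ 3 * n ^ 10 * d ^ 8"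
      using power_mono[OF g(2,1)] by (meson order_trans)
    then have "(d * real \<tau> ^ 3) ^ 4 \<le> k ^ 3 * m ^ 3 * n ^ 10"
      using True \<tau>n \<tau> g m k by (intro trichotomy_algebra_A) (auto simp: n_def d_def)
    then show ?thesis by (simp add: d_def k_def m_def n_def)
  next
    case False
    define g where "g = (\<Sum>x\<in>D. real (card (fib (uminus ` A) A x)))"
    have "(\<Sum>x\<in>D. real (rdiff A x)) \<le> g"
      unfolding g_def by (intro sum_mono of_nat_mono rdiff_le_card_fib A)
    with sum_ge pos have g: "0 \<le> d * \<tau>" "d * \<tau> \<le> g" "0 < g" by linarith+
    have card_neg: "card (uminus ` A) = card A" by (simp add: card_image)
    have "g\<^sup>2 \<le> 32 * d\<^sup>2 * m \<or> g ^ 6 \<le> k * m\<^sup>2 * d ^ 4 * n ^ 4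
        \<or> g ^ 12 \<le> (k * m) ^ 3 * d ^ 10 * n ^ 8"
      using fib_sum_trichotomy[of D "uminus ` A" A] A finD False g(3) \<open>D \<noteq> {}\<close>
      unfolding g_def n_def m_def k_def d_def card_neg by fastforce
    then have "(d * \<tau>)\<^sup>2 \<le> 32 * d\<^sup>2 * m \<or> (d * \<tau>) ^ 6 \<le> k * m\<^sup>2 * d ^ 4 * n ^ 4
        \<or> (d * \<tau>) ^ 12 \<le> (k * m) ^ 3 * d ^ 10 * n ^ 8"
      using power_mono[OF g(2,1)] by (meson order_trans)
    then have "(d * real \<tau> ^ 3) ^ 4 \<le> k ^ 3 * m ^ 3 * n ^ 10"
      using False \<tau>n \<tau> d m k by (intro trichotomy_algebra_D) (auto simp: n_def d_def)
    then show ?thesis by (simp add: d_def k_def m_def n_def)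
  qed
qed (simp add: harm_nonneg)

section \<open>Summation over all levels and the final exponents\<close>

lemma harm_le_ln:
  assumes "n > 0"
  shows "harm n \<le> 1 + ln (real n)"
proof -
  obtain k where "n = Suc k" using assms gr0_conv_Suc by blast
  then show ?thesis using decseqD[OF decseq_harm_diff_ln, of 0 k] by (simp add: harm_expand)
qed

text \<open>Layer cake for cubes: the weight \<open>3 * t\<^sup>2\<close> against the level bound
  \<open>B / t ^ 3\<close> leaves a second harmonic sum.\<close>

lemma E3plus_le:
  assumes A: "finite A" "0 \<notin> A"
  shows "E3plus A \<le> 3 * ((49280 * harm (card A)) ^ 3 * real (card (prod_set A)) ^ 3
    * real (card A) ^ 10) powr (1 / 4) * harm (card A)"
proof -
  define D where "D t = {x \<in> diff_set A. t \<le> rdiff A x}" for t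
  define X where "X = (49280 * harm (card A)) ^ 3 * real (card (prod_set A)) ^ 3 * real (card A) ^ 10"
  define B where "B = X powr (1 / 4)"
  have "X \<ge> 0" by (simp add: X_def harm_nonneg)
  have bound: "(real t)\<^sup>2 * card (D t) \<le> B * (1 / real t)" if "t \<ge> 1" for t
  proof -
    have "(real (card (D t)) * real t ^ 3) ^ 4 \<le> X"
      unfolding X_def D_def using that by (intro card_popular_differences_le A) auto
    also have "X = B ^ 4" using \<open>X \<ge> 0\<close> by (simp add: B_def flip: powr_numeral add: powr_powr powr_realpow')
    finally have "real (card (D t)) * real t ^ 3 \<le> B"
      using power_less_imp_less_base power_strict_mono[of B "real (card (D t)) * real t ^ 3" 4]
      by (force simp: B_def)
    then show ?thesis using that
      by (simp add: pos_le_divide_eq power2_eq_square power3_eq_cube mult_ac)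
  qed
  have "real (E3plus A) = (\<Sum>x\<in>diff_set A. real (rdiff A x) ^ 3)" by (simp add: E3plus_def)
  also have "\<dots> \<le> (\<Sum>x\<in>diff_set A. \<Sum>t=1..rdiff A x. 3 * (real t)\<^sup>2)"
    by (intro sum_mono cube_le_sum)
  also have "\<dots> = (\<Sum>t=1..card A. 3 * (real t)\<^sup>2 * card (D t))"
    unfolding D_def using A by (intro sum_layer_cake finite_diff_set rdiff_le_card)
  also have "\<dots> \<le> (\<Sum>t=1..card A. 3 * B * (1 / real t))"
  proof (rule sum_mono)
    fix t assume "t \<in> {1..card A}"
    then show "3 * (real t)\<^sup>2 * card (D t) \<le> 3 * B * (1 / real t)" using bound[of t] by simp
  qed
  also have "\<dots> = 3 * B * harm (card A)" by (simp add: harm_def sum_distrib_left divide_inverse)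
  finally show ?thesis by (simp add: B_def X_def)
qed

theorem mainTheorem7:
  shows "\<exists>C c :: real. C > 0 \<and> c > 0 \<and>
    (\<forall>A :: real set. finite A \<longrightarrow> A \<noteq> {} \<longrightarrow> 0 \<notin> A \<longrightarrow>
       real (E3plus A) powr (4/3) * real (card A) powr (-10/3)
         \<le> C * real (card (prod_set A)) * (ln (2 + real (card A))) powr c)"
\<comment> \<open>The exponent is 7/3 = 1 + 4/3: one factor \<open>H\<close> sits in
  \<open>k\<close>, and \<open>H powr (4/3)\<close> comes from the sum over levels. The factor
  \<open>2 powr (7/3)\<close> comes from \<open>H \<le> 2 * ln (2 + n)\<close>.\<close>
proof (rule exI[of _ "3 powr (4/3) * 49280 * 2 powr (7/3)"], rule exI[of _ "7/3"], intro conjI allI impI)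
  fix A :: "real set"
  assume A: "finite A" "A \<noteq> {}" "0 \<notin> A"
  define n m H where "n = real (card A)" and "m = real (card (prod_set A))"
    and "H = (harm (card A) :: real)"
  have cardA: "card A > 0" using A by (simp add: card_gt_0_iff)
  then have n: "n \<ge> 1" by (simp add: n_def)
  have H: "H \<ge> 1" using harm_ge_1 cardA by (simp add: H_def)
  have m: "m \<ge> 0" by (simp add: m_def)
  have H_le: "H \<le> 2 * ln (2 + n)"
  proof -
    have "ln n \<le> ln (2 + n)" using n by simp
    moreover have "1 \<le> ln (2 + n)"
    proof -
      have "exp 1 \<le> 2 + n" using exp_le n by linarith
      then show ?thesis using n by (subst ln_ge_iff) auto
    qed
    ultimately show ?thesis using harm_le_ln[OF cardA] by (simp add: H_def n_def)
  qed
  define k where "k = 49280 * H"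
  have k: "k \<ge> 0" using H by (simp add: k_def)
  define Y where "Y = k ^ 3 * m ^ 3 * n ^ 10"
  have "Y \<ge> 0" using k m n by (simp add: Y_def)
  \<comment> \<open>Raising the bound to the power 4/3 turns \<open>Y powr (1/4)\<close> into this;
    its power of \<open>n\<close> cancels \<open>n powr (-10/3)\<close>, and \<open>m\<close>
    remains to the first power.\<close>
  have Y13: "Y powr (1/3) = k * m * n powr (10/3)"
  proof -
    have root3: "(x ^ j) powr (1/3) = x powr (real j / 3)" if "0 \<le> x" "j \<noteq> 0" for x :: real and j
      using powr_powr[of x "real j" "1/3"] powr_realpow'[OF that] by simp
    show ?thesis
      unfolding Y_def using k m n by (simp add: powr_mult root3)
  qed
  have "real (E3plus A) \<le> 3 * Y powr (1/4) * H"
    using E3plus_le[OF A(1,3)] by (simp add: Y_def k_def H_def m_def n_def)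
  then have "real (E3plus A) powr (4/3) \<le> (3 * Y powr (1/4) * H) powr (4/3)"
    by (intro powr_mono2) auto
  also have "\<dots> = 3 powr (4/3) * Y powr (1/3) * H powr (4/3)"
    using H \<open>Y \<ge> 0\<close> by (simp add: powr_mult powr_powr)
  finally have "real (E3plus A) powr (4/3) * n powr (-10/3)
      \<le> 3 powr (4/3) * Y powr (1/3) * H powr (4/3) * n powr (-10/3)"
    by (intro mult_right_mono) auto
  also have "\<dots> = 3 powr (4/3) * 49280 * m * (H powr 1 * H powr (4/3)) * (n powr (10/3) * n powr (-10/3))"
    unfolding Y13 k_def using H by simp
  also have "\<dots> = 3 powr (4/3) * 49280 * m * H powr (7/3)"
    unfolding powr_add[symmetric] using n by simp
  also have "\<dots> \<le> 3 powr (4/3) * 49280 * m * (2 * ln (2 + n)) powr (7/3)"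
    using H H_le m by (intro mult_left_mono powr_mono2) auto
  also have "\<dots> = 3 powr (4/3) * 49280 * 2 powr (7/3) * m * ln (2 + n) powr (7/3)"
    using n by (simp add: powr_mult)
  finally show "real (E3plus A) powr (4/3) * real (card A) powr (-10/3)
      \<le> 3 powr (4/3) * 49280 * 2 powr (7/3) * real (card (prod_set A)) * ln (2 + real (card A)) powr (7/3)"
    by (simp only: n_def m_def)
qed auto

end
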